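(* For all natural numbers $n\ge 3$ and $k\ge 1$, the graph $P_{2k}\Box C_n$ is non-distance magic (NDM).
   Context: All graphs are finite, undirected and simple. $P_r$ is the path on $r$ vertices, $C_n$ is the cycle on $n$ vertices, and $G\Box H$ is the Cartesian product: vertex set $V(G)\times V(H)$, with $(u,v)$ adjacent to $(u',v')$ iff either $u=u'$ and $vv'\in E(H)$, or $v=v'$ and $uu'\in E(G)$. For $u\in V(G)$, $N(u)=\{v\in V(G): uv\in E(G)\}$. Let $G$ be a graph with $p$ vertices. A bijection $f:V(G)\to\{1,2,\dots,p\}$ is a distance magic labeling of $G$ if $\sum_{v\in N(u)}f(v)$ is the same constant for all $u\in V(G)$. $G$ is a distance magic graph if it has a distance magic labeling; otherwise it is non-distance magic (NDM). *)

theory Defs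
  imports "Graph_Theory.Pair_Digraph"
begin

text \<open>
  A finite simple graph is a \<^locale>\<open>pair_graph\<close> of the entry \<open>Graph_Theory\<close>: a finite vertex set
  together with an irreflexive symmetric set of arcs, each edge \<open>uv\<close> being represented by the two
  arcs \<open>(u, v)\<close> and \<open>(v, u)\<close>.
\<close>

definition path_graph :: "nat \<Rightarrow> nat pair_pre_digraph" where
  "path_graph r = \<lparr> pverts = {0..<r},
     parcs = {(i, j). i < r \<and> j < r \<and> (j = i + 1 \<or> i = j + 1)} \<rparr>"

text \<open>For \<open>n < 3\<close> the following is not the cycle on \<open>n\<close> vertices (for \<open>n = 1\<close> it has a loop).\<close>

definition cycle_graph :: "nat \<Rightarrow> nat pair_pre_digraph" where
  "cycle_graph n = \<lparr> pverts = {0..<n},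
     parcs = {(i, j). i < n \<and> j < n \<and> (j = (i + 1) mod n \<or> i = (j + 1) mod n)} \<rparr>"

definition cartesian_product ::
    "'a pair_pre_digraph \<Rightarrow> 'b pair_pre_digraph \<Rightarrow> ('a \<times> 'b) pair_pre_digraph"
    (infixl "\<box>" 70) where
  "G \<box> H = \<lparr> pverts = pverts G \<times> pverts H,
     parcs = {((u, v), (u', v')).
        (u, v) \<in> pverts G \<times> pverts H \<and> (u', v') \<in> pverts G \<times> pverts H \<and>
        (u = u' \<and> (v, v') \<in> parcs H \<or> v = v' \<and> (u, u') \<in> parcs G)} \<rparr>"

definition neighborhood :: "'a pair_pre_digraph \<Rightarrow> 'a \<Rightarrow> 'a set" where
  "neighborhood G u = {v \<in> pverts G. (u, v) \<in> parcs G}"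

definition distance_magic_labeling :: "'a pair_pre_digraph \<Rightarrow> ('a \<Rightarrow> nat) \<Rightarrow> bool" where
  "distance_magic_labeling G f \<longleftrightarrow>
     bij_betw f (pverts G) {1..card (pverts G)} \<and>
     (\<exists>c. \<forall>u\<in>pverts G. (\<Sum>v\<in>neighborhood G u. f v) = c)"

definition distance_magic :: "'a pair_pre_digraph \<Rightarrow> bool" where
  "distance_magic G \<longleftrightarrow> (\<exists>f. distance_magic_labeling G f)"

definition non_distance_magic :: "'a pair_pre_digraph \<Rightarrow> bool" where
  "non_distance_magic G \<longleftrightarrow> \<not> distance_magic G"

lemma pair_graph_path_graph: "pair_graph (path_graph r)"
proof -
  have "finite (parcs (path_graph r))"
    by (rule finite_subset[of _ "{0..<r} \<times> {0..<r}"]) (auto simp: path_graph_def)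
  then show ?thesis
    by unfold_locales (auto simp: path_graph_def symmetric_def intro!: symI)
qed

lemma pair_graph_cycle_graph:
  assumes "n \<ge> 3"
  shows "pair_graph (cycle_graph n)"
proof -
  have loopfree: "i \<noteq> (i + 1) mod n" if "i < n" for i
  proof (cases "i + 1 = n")
    case False
    with that have "(i + 1) mod n = i + 1" by (intro mod_less) linarith
    then show ?thesis by linarith
  qed (use assms in simp)
  have arcs: "(i, j) \<in> parcs (cycle_graph n) \<longleftrightarrow>
      i < n \<and> j < n \<and> (j = (i + 1) mod n \<or> i = (j + 1) mod n)" for i j
    unfolding cycle_graph_def by simp
  have verts: "pverts (cycle_graph n) = {0..<n}"
    unfolding cycle_graph_def by simp
  have fst: "fst e < n" and snd: "snd e < n" and neq: "fst e \<noteq> snd e"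
    if "e \<in> parcs (cycle_graph n)" for e
    using that arcs[of "fst e" "snd e"] loopfree[of "fst e"] unfolding prod.collapse by metis+
  have "finite (parcs (cycle_graph n))"
    by (rule finite_subset[of _ "{0..<n} \<times> {0..<n}"]) (auto dest: fst snd)
  moreover have "symmetric (cycle_graph n)"
    unfolding symmetric_def with_proj_simps using arcs by (intro symI) metis
  ultimately show ?thesis
    by unfold_locales (simp_all add: verts fst snd neq)
qed

lemma pair_graph_cartesian_product:
  assumes "pair_graph G" and "pair_graph H"
  shows "pair_graph (G \<box> H)"
proof -
  interpret G: pair_graph G by fact
  interpret H: pair_graph H by fact
  have "finite (pverts (G \<box> H))"
    using G.pair_finite_verts H.pair_finite_verts by (simp add: cartesian_product_def)
  moreover have "parcs (G \<box> H) \<subseteq> pverts (G \<box> H) \<times> pverts (G \<box> H)"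
    by (auto simp: cartesian_product_def)
  ultimately have "finite (parcs (G \<box> H))"
    by (meson finite_SigmaI finite_subset)
  moreover have "sym (parcs (G \<box> H))"
    by (rule symI)
      (auto simp: cartesian_product_def intro: G.arcs_symmetric H.arcs_symmetric)
  moreover have "fst e \<noteq> snd e" if "e \<in> parcs (G \<box> H)" for e
    using that G.no_loops' H.no_loops' by (fastforce simp: cartesian_product_def)
  ultimately show ?thesis
    using \<open>finite (pverts (G \<box> H))\<close>
    by unfold_locales (simp_all add: symmetric_def, auto simp: cartesian_product_def)
qed

end

theory Submission
  imports Defs
begin

text \<open>
  Write \<open>x i v\<close> for the label of vertex \<open>v mod n\<close> of the cycle in the copy number \<open>i \<in> {1..2k}\<close>,
  and put \<open>x 0 v = x (2k + 1) v = 0\<close>. The magic condition at \<open>(i, v + 1)\<close> says that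
  \<open>D i v = x (i + 1) (v + 1) + x i v\<close> satisfies \<open>D i v + D (i - 1) (v + 1) = c\<close>, so that
  \<open>D (i + 2) v = D i (v + 2)\<close>: as for the discrete wave equation, \<open>D\<close> is transported along
  diagonals. Going from \<open>i = 0\<close> to \<open>i = 2k\<close> yields \<open>x (2k) v = x 1 (v + 2k + 1)\<close>, so two
  different vertices have the same label.
\<close>

lemma sum_neighborhood_cartesian_product:
  fixes f :: "'a \<times> 'b \<Rightarrow> nat"
  assumes "pair_graph G" and "pair_graph H" and "u \<in> pverts G" and "v \<in> pverts H"
  shows "(\<Sum>w\<in>neighborhood (G \<box> H) (u, v). f w) =
    (\<Sum>u'\<in>neighborhood G u. f (u', v)) + (\<Sum>v'\<in>neighborhood H v. f (u, v'))"
proof -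
  interpret G: pair_graph G by fact
  interpret H: pair_graph H by fact
  have "neighborhood (G \<box> H) (u, v) =
      (\<lambda>u'. (u', v)) ` neighborhood G u \<union> Pair u ` neighborhood H v"
    using assms(3,4) by (auto simp: neighborhood_def cartesian_product_def)
  \<comment> \<open>A common element would be \<open>(u, v)\<close> itself, forcing a loop at
    \<open>u\<close>.\<close>
  moreover have "(\<lambda>u'. (u', v)) ` neighborhood G u \<inter> Pair u ` neighborhood H v = {}"
    using G.no_loops' by (auto simp: neighborhood_def)
  moreover have "finite (neighborhood G u)" "finite (neighborhood H v)"
    by (simp_all add: neighborhood_def)
  ultimately show ?thesis
    by (simp add: sum.union_disjoint sum.reindex inj_on_def)
qed

lemma sum_neighborhood_path_graph:
  fixes g :: "nat \<Rightarrow> nat"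
  assumes "i < r"
  shows "(\<Sum>j\<in>neighborhood (path_graph r) i. g j) =
    (if i = 0 then 0 else g (i - 1)) + (if i + 1 < r then g (i + 1) else 0)"
proof -
  have "neighborhood (path_graph r) i =
      (if i = 0 then {} else {i - 1}) \<union> (if i + 1 < r then {i + 1} else {})"
    using assms by (auto simp: neighborhood_def path_graph_def)
  then show ?thesis by simp
qed

text \<open>The successor map modulo \<open>n\<close> is injective on residues, so the predecessor
  is unique. Centring at \<open>v + 1\<close> avoids subtraction modulo \<open>n\<close>.\<close>

lemma neighborhood_cycle_graph:
  assumes "n > 0"
  shows "neighborhood (cycle_graph n) ((v + 1) mod n) = {v mod n, (v + 2) mod n}"
proof -
  have "j = v mod n" if "j < n" "(v + 1) mod n = (j + 1) mod n" for j
    using that by (auto simp: mod_Suc split: if_splits)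
  then show ?thesis
    using assms by (auto simp: neighborhood_def cycle_graph_def mod_Suc_eq)
qed

text \<open>Equality would make \<open>n\<close> divide 2. This keeps the two cycle neighbours
  apart, so that both labels are counted.\<close>

lemma mod_add_2_neq:
  fixes v n :: nat
  assumes "n \<ge> 3"
  shows "v mod n \<noteq> (v + 2) mod n"
  using assms by (metis mod_eq_dvd_iff_nat le_add1 add_diff_cancel_left' dvd_imp_le
    zero_less_numeral not_less_eq_eq eval_nat_numeral(3))

theorem corollary3p7:
  fixes n k :: nat
  assumes "n \<ge> 3" and "k \<ge> 1"
  shows "non_distance_magic (path_graph (2 * k) \<box> cycle_graph n)"
  unfolding non_distance_magic_def distance_magic_def
proof
  let ?G = "path_graph (2 * k) \<box> cycle_graph n"
  have verts: "pverts ?G = {0..<2 * k} \<times> {0..<n}"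
    by (simp add: cartesian_product_def path_graph_def cycle_graph_def)
  assume "\<exists>f. distance_magic_labeling ?G f"
  then obtain f :: "nat \<times> nat \<Rightarrow> nat" and c where inj: "inj_on f (pverts ?G)"
    and magic: "\<And>u. u \<in> pverts ?G \<Longrightarrow> (\<Sum>v\<in>neighborhood ?G u. f v) = c"
    unfolding distance_magic_labeling_def bij_betw_def by blast
  define x where "x i v = (if i = 0 \<or> i > 2 * k then 0 else f (i - 1, v mod n))" for i v
  define D where "D i v = x (i + 1) (v + 1) + x i v" for i v
  \<comment> \<open>Path vertices start at 0, so path vertex \<open>i\<close> is row
    \<open>i + 1\<close> of \<open>x\<close>.\<close>
  have rec: "D (i + 1) v + D i (v + 1) = c" if "i < 2 * k" for i v
  proof -
    have "c = (\<Sum>w\<in>neighborhood ?G (i, (v + 1) mod n). f w)"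
      using that assms(1) by (intro magic [symmetric]) (simp add: verts)
    also have "\<dots> = (\<Sum>j\<in>neighborhood (path_graph (2 * k)) i. f (j, (v + 1) mod n)) +
        (\<Sum>w\<in>neighborhood (cycle_graph n) ((v + 1) mod n). f (i, w))"
      using that assms(1)
      by (intro sum_neighborhood_cartesian_product pair_graph_path_graph pair_graph_cycle_graph)
        (simp_all add: path_graph_def cycle_graph_def)
    \<comment> \<open>At an end of the path, the zero row \<open>0\<close> or
      \<open>2 * k + 1\<close> stands for the missing neighbour.\<close>
    also have "(\<Sum>j\<in>neighborhood (path_graph (2 * k)) i. f (j, (v + 1) mod n)) =
        x i (v + 1) + x (i + 2) (v + 1)"
      unfolding sum_neighborhood_path_graph [OF that] using that by (auto simp: x_def)
    also have "(\<Sum>w\<in>neighborhood (cycle_graph n) ((v + 1) mod n). f (i, w)) =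
        x (i + 1) v + x (i + 1) (v + 2)"
      using that assms(1) mod_add_2_neq [OF assms(1), of v]
      by (subst neighborhood_cycle_graph) (simp_all add: x_def)
    finally show ?thesis by (simp add: D_def)
  qed
  have transport: "D (2 * j) v = D 0 (v + 2 * j)" if "j \<le> k" for j v
    using that
  proof (induction j arbitrary: v)
    case (Suc j)
    have "D (2 * Suc j) v + D (2 * j + 1) (v + 1) = c"
      using rec [of "2 * j + 1" v] Suc.prems by simp
    moreover have "D (2 * j + 1) (v + 1) + D (2 * j) (v + 2) = c"
      using rec [of "2 * j" "v + 1"] Suc.prems by simp
    ultimately have "D (2 * Suc j) v = D (2 * j) (v + 2)" by linarith
    with Suc show ?case by simp
  qed simp
  \<comment> \<open>The zero rows reduce \<open>D (2 * k) 0\<close> and \<open>D 0 (2 * k)\<close>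
    to one label each.\<close>
  have "f (2 * k - 1, 0) = f (0, (2 * k + 1) mod n)"
    using transport [of k 0] assms by (simp add: D_def x_def)
  then have "(2 * k - 1, 0) = (0 :: nat, (2 * k + 1) mod n)"
    using inj assms by (elim inj_onD) (simp_all add: verts)
  \<comment> \<open>As \<open>2 * k \<ge> 2\<close>, the first and the last copy differ, whatever
    the cycle coordinates are.\<close>
  then show False using assms(2) by simp
qed

end
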